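(* For every $d\ge 3$ there is a constant $c=c(d)$ such that for all $n\ge 2$, $OSH_d(n)\le\mathrm{twr}_{d-1}(c n^2\log n)$.
   Context: The tower function is defined by $\mathrm{twr}_1(x)=x$ and $\mathrm{twr}_{i+1}(x)=2^{\mathrm{twr}_i(x)}$. A set $H$ of hyperplanes in $\mathbb{R}^d$ is in general position if every $d$ members of $H$ intersect in a single point, distinct for distinct $d$-subsets. Such $H$ is one-sided if the vertex set of its arrangement (the set of all these intersection points) lies entirely on one side of the hyperplane $x_d=0$. $OSH_d(n)$ is the smallest integer $N$ such that every set of $N$ hyperplanes in $\mathbb{R}^d$ in general position contains $n$ members that are one-sided. *)

theory Defs
  imports Complex_Main "Jordan_Normal_Form.Matrix"
begin

text \<open>The tower function is indexed from 1; the value at index 0 is a dummy.\<close>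

fun twr :: "nat \<Rightarrow> real \<Rightarrow> real" where
  "twr 0 x = x"
| "twr (Suc 0) x = x"
| "twr (Suc (Suc i)) x = 2 powr twr (Suc i) x"

text \<open>Euclidean \<open>d\<close>-space is \<^term>\<open>carrier_vec d :: real vec set\<close>, so that the dimension
  can be quantified over. A hyperplane is an affine one, identified with its point set.\<close>

definition is_hyperplane :: "nat \<Rightarrow> real vec set \<Rightarrow> bool" where
  "is_hyperplane d h \<longleftrightarrow>
     (\<exists>a \<in> carrier_vec d. \<exists>b. a \<noteq> 0\<^sub>v d \<and> h = {x \<in> carrier_vec d. a \<bullet> x = b})"

definition general_position :: "nat \<Rightarrow> real vec set set \<Rightarrow> bool" where
  "general_position d H \<longleftrightarrow>
     (\<forall>S. S \<subseteq> H \<and> card S = d \<longrightarrow> (\<exists>v. \<Inter>S = {v})) \<and>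
     (\<forall>S T. S \<subseteq> H \<and> card S = d \<and> T \<subseteq> H \<and> card T = d \<and> S \<noteq> T \<longrightarrow> \<Inter>S \<noteq> \<Inter>T)"

definition arrangement_vertices :: "nat \<Rightarrow> real vec set set \<Rightarrow> real vec set" where
  "arrangement_vertices d H = {v. \<exists>S. S \<subseteq> H \<and> card S = d \<and> \<Inter>S = {v}}"

text \<open>Coordinates are numbered from 0, so the last coordinate has index \<^term>\<open>d - 1\<close>.
  The sides of a hyperplane are the two open half-spaces: a vertex on the hyperplane itself
  is on neither side.\<close>

definition one_sided :: "nat \<Rightarrow> real vec set set \<Rightarrow> bool" where
  "one_sided d H \<longleftrightarrow>
     (\<forall>v \<in> arrangement_vertices d H. v $ (d - 1) > 0) \<or>
     (\<forall>v \<in> arrangement_vertices d H. v $ (d - 1) < 0)"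

definition forces_one_sided :: "nat \<Rightarrow> nat \<Rightarrow> nat \<Rightarrow> bool" where
  "forces_one_sided d n N \<longleftrightarrow>
     (\<forall>H. finite H \<and> card H = N \<and> (\<forall>h \<in> H. is_hyperplane d h) \<and> general_position d H \<longrightarrow>
        (\<exists>K. K \<subseteq> H \<and> card K = n \<and> one_sided d K))"

text \<open>\<open>LEAST\<close> is only meaningful if some \<^term>\<open>N\<close> has the property; statements about
  \<open>OSH\<close> therefore have to assert this existence separately.\<close>

definition OSH :: "nat \<Rightarrow> nat \<Rightarrow> nat" where
  "OSH d n = (LEAST N. forces_one_sided d n N)"

end

theory Submission
  imports Defs
begin

text \<open>Hyperplanes are linear equations \<open>\<Sum>k\<in>X. a i k * x k = b i\<close> in a finite set \<open>X\<close> of variables, and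
  \<open>z \<in> X\<close> plays the role of the last coordinate. Inside a fixed hyperplane, a variable \<open>j \<noteq> z\<close> can be
  eliminated: the other hyperplanes cut out an arrangement of one dimension less, whose vertices
  keep their \<open>z\<close>-coordinate. The Erdos-Rado argument selects a sequence of hyperplanes for which the
  side of a vertex does not depend on its last hyperplane; replacing that one by the last member of
  the sequence reduces the dimension by one at the cost of one exponential.

  In the plane the side of a vertex is decided by comparing slopes and intercepts, so the
  Erdos-Szekeres argument gives a quadratic bound \<open>M = 4 n\<^sup>2\<close>. In the step to dimension three, the planes
  are compared within a fixed plane, where they leave only polynomially many classes at each of
  the \<open>M + 1\<close> selections; this gives \<open>2\<close> to the power \<open>O (M log M)\<close>, whereas the trivial count of
  classes would give an exponent of order \<open>M\<^sup>2\<close>. In higher dimensions the trivial count suffices, as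
  a polynomial loss below two exponentials is absorbed by the constant.\<close>

section \<open>Linear equations in general position\<close>

definition sols :: "('i \<Rightarrow> nat \<Rightarrow> real) \<Rightarrow> ('i \<Rightarrow> real) \<Rightarrow> nat set \<Rightarrow> 'i set \<Rightarrow> (nat \<Rightarrow> real) \<Rightarrow> bool" where
  "sols a b X T x \<longleftrightarrow> (\<forall>i\<in>T. (\<Sum>k\<in>X. a i k * x k) = b i)"

text \<open>Equations are indexed rather than collected in a set, so that they keep their names
  under elimination. The clause on \<open>Suc (card X)\<close> equations states the distinctness of
  vertices in a form that elimination preserves. Solutions are functions on all of
  \<open>nat\<close>, hence uniqueness only on \<open>X\<close>.\<close>

definition gen_pos :: "('i \<Rightarrow> nat \<Rightarrow> real) \<Rightarrow> ('i \<Rightarrow> real) \<Rightarrow> nat set \<Rightarrow> 'i set \<Rightarrow> bool" where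
  "gen_pos a b X I \<longleftrightarrow>
     (\<forall>T. T \<subseteq> I \<and> card T = card X \<longrightarrow>
        (\<exists>x. sols a b X T x) \<and> (\<forall>x y. sols a b X T x \<and> sols a b X T y \<longrightarrow> (\<forall>k\<in>X. x k = y k))) \<and>
     (\<forall>T x. T \<subseteq> I \<and> card T = Suc (card X) \<longrightarrow> \<not> sols a b X T x)"

text \<open>The sign of the \<open>z\<close>-coordinate of the vertex determined by the equations \<open>T\<close>; the choice is
  unique only if \<open>T\<close> has as many members as \<open>X\<close>, in general position.\<close>

definition side :: "('i \<Rightarrow> nat \<Rightarrow> real) \<Rightarrow> ('i \<Rightarrow> real) \<Rightarrow> nat set \<Rightarrow> nat \<Rightarrow> 'i set \<Rightarrow> real" where
  "side a b X z T = sgn ((SOME x. sols a b X T x) z)"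

definition homogeneous :: "('i \<Rightarrow> nat \<Rightarrow> real) \<Rightarrow> ('i \<Rightarrow> real) \<Rightarrow> nat set \<Rightarrow> nat \<Rightarrow> 'i set \<Rightarrow> bool" where
  "homogeneous a b X z K \<longleftrightarrow>
     (\<exists>s\<in>{1, -1}. \<forall>T. T \<subseteq> K \<and> card T = card X \<longrightarrow> side a b X z T = s)"

text \<open>\<open>X\<close> and \<open>z\<close> are arbitrary because each elimination may remove
  a different variable. The type argument fixes the index type, which does not occur in the other
  arguments.\<close>

definition forces_homogeneous :: "'i itself \<Rightarrow> nat \<Rightarrow> nat \<Rightarrow> nat \<Rightarrow> bool" where
  "forces_homogeneous _ d n N \<longleftrightarrow>
     (\<forall>(a :: 'i \<Rightarrow> nat \<Rightarrow> real) b X z I. finite X \<and> card X = d \<and> z \<in> X \<and> finite I \<and> N \<le> card I \<and> gen_pos a b X I \<longrightarrow>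
        (\<exists>K. K \<subseteq> I \<and> card K = n \<and> homogeneous a b X z K))"

lemma sols_insert:
  "sols a b X (insert i T) x \<longleftrightarrow> (\<Sum>k\<in>X. a i k * x k) = b i \<and> sols a b X T x"
  by (auto simp: sols_def)

lemma gen_pos_subset: "gen_pos a b X I \<Longrightarrow> J \<subseteq> I \<Longrightarrow> gen_pos a b X J"
  unfolding gen_pos_def by (meson subset_trans)

lemma gen_posD:
  assumes "gen_pos a b X I" "T \<subseteq> I" "card T = card X"
  shows "\<exists>x. sols a b X T x" "sols a b X T x \<Longrightarrow> sols a b X T y \<Longrightarrow> k \<in> X \<Longrightarrow> x k = y k"
  using assms unfolding gen_pos_def by blast+

lemma gen_pos_no_sols:
  "gen_pos a b X I \<Longrightarrow> T \<subseteq> I \<Longrightarrow> card T = Suc (card X) \<Longrightarrow> \<not> sols a b X T x"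
  unfolding gen_pos_def by blast

lemma side_eq:
  assumes "gen_pos a b X I" "T \<subseteq> I" "card T = card X" "sols a b X T x" "z \<in> X"
  shows "side a b X z T = sgn (x z)"
proof -
  have "sols a b X T (SOME x. sols a b X T x)"
    using assms(4) by (rule someI[of "sols a b X T"])
  then have "(SOME x. sols a b X T x) z = x z"
    using gen_posD(2)[OF assms(1-3) _ assms(4,5)] by blast
  then show ?thesis
    by (simp add: side_def)
qed

lemma side_values: "side a b X z T \<in> {-1, 0, 1}"
  by (simp add: side_def sgn_if)

text \<open>Such an equation involves only \<open>x z\<close>. If two of them have a common vertex,
  they fix the same value of \<open>x z\<close> or one of them reads 0 = 0; either way some solution
  of \<open>card X\<close> equations satisfies a further one. Hence at most one equation offers no
  variable other than \<open>z\<close> for elimination.\<close>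

lemma unique_degenerate_equation:
  assumes gp: "gen_pos a b X I" and fX: "finite X" and z: "z \<in> X" and fI: "finite I"
    and big: "card X < card I" and X2: "2 \<le> card X"
    and i: "i1 \<in> I" "\<forall>k\<in>X - {z}. a i1 k = 0" and j: "i2 \<in> I" "\<forall>k\<in>X - {z}. a i2 k = 0"
  shows "i1 = i2"
proof (rule ccontr)
  assume ne: "i1 \<noteq> i2"
  have lin: "(\<Sum>k\<in>X. a i k * x k) = a i z * x z" if "\<forall>k\<in>X - {z}. a i k = 0" for i x
    using that fX z by (simp add: sum.remove)
  have "card (I - {i1}) \<ge> card X"
    using big fI i(1) by (simp add: card_Diff_singleton)
  then obtain R where R: "R \<subseteq> I - {i1}" "card R = card X" "i2 \<in> R"
  proof -
    have "card X - 1 \<le> card (I - {i1} - {i2})"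
      using big fI i j ne by (simp add: card_Diff_singleton)
    then obtain S where S: "S \<subseteq> I - {i1} - {i2}" "card S = card X - 1"
      by (meson obtain_subset_with_card_n)
    have "finite S" using S fI by (meson finite_Diff finite_subset)
    then have "card (insert i2 S) = card X"
      using S X2 by (subst card_insert_disjoint) auto
    then show ?thesis using that[of "insert i2 S"] S j ne by auto
  qed
  obtain T where T: "T \<subseteq> I" "card T = card X" "i1 \<in> T" "i2 \<in> T"
  proof -
    have "card X - 2 \<le> card (I - {i1} - {i2})"
      using big fI i j ne by (simp add: card_Diff_singleton)
    then obtain S where S: "S \<subseteq> I - {i1} - {i2}" "card S = card X - 2"
      by (meson obtain_subset_with_card_n)
    have "finite S" using S fI by (meson finite_Diff finite_subset)
    then have "card (insert i1 (insert i2 S)) = card X"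
      using S X2 ne by (subst card_insert_disjoint, force, force)+ auto
    then show ?thesis using that[of "insert i1 (insert i2 S)"] S i j by auto
  qed
  obtain y where y: "sols a b X T y" using gen_posD(1)[OF gp T(1,2)] by blast
  then have y12: "a i1 z * y z = b i1" "a i2 z * y z = b i2"
    using T lin[OF i(2)] lin[OF j(2)] by (auto simp: sols_def)
  have RI: "R \<subseteq> I" using R by auto
  obtain x where x: "sols a b X R x" using gen_posD(1)[OF gp RI R(2)] by blast
  then have x2: "a i2 z * x z = b i2"
    using R lin[OF j(2)] by (auto simp: sols_def)
  have fR: "finite R" using RI fI finite_subset by blast
  show False
  proof (cases "a i2 z = 0")
    case True
    text \<open>The equation \<open>i2\<close> reads \<open>0 = 0\<close>.\<close>
    have "card X \<le> card (I - {i2})"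
      using big fI j by (simp add: card_Diff_singleton)
    then obtain S where S: "S \<subseteq> I - {i2}" "card S = card X"
      by (meson obtain_subset_with_card_n)
    then obtain w where "sols a b X S w" using gen_posD(1)[OF gp, of S] by blast
    then have "sols a b X (insert i2 S) w"
      using True y12 lin[OF j(2)] by (simp add: sols_insert)
    moreover have "card (insert i2 S) = Suc (card X)"
      using S fI by (subst card_insert_disjoint) (auto intro: finite_subset)
    ultimately show False
      using gen_pos_no_sols[OF gp, of "insert i2 S"] S j by blast
  next
    case False
    then have "x z = y z" using x2 y12 by (metis mult_left_cancel)
    then have "sols a b X (insert i1 R) x"
      using x y12 lin[OF i(2)] by (simp add: sols_insert)
    moreover have "card (insert i1 R) = Suc (card X)"
      using R fR by (subst card_insert_disjoint) auto
    ultimately show False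
      using gen_pos_no_sols[OF gp, of "insert i1 R"] RI i by blast
  qed
qed

lemma card_nondegenerate:
  assumes "gen_pos a b X I" "finite X" "z \<in> X" "finite I" "card X < card I" "2 \<le> card X"
  shows "card I \<le> Suc (card {i \<in> I. \<exists>k\<in>X - {z}. a i k \<noteq> 0})"
proof -
  let ?D = "{i \<in> I. \<forall>k\<in>X - {z}. a i k = 0}"
  have "card ?D \<le> Suc 0"
    using unique_degenerate_equation[OF assms] assms(4)
    by (auto simp: card_le_Suc0_iff_eq)
  moreover have "{i \<in> I. \<exists>k\<in>X - {z}. a i k \<noteq> 0} \<union> ?D = I" by auto
  then have "card I \<le> card {i \<in> I. \<exists>k\<in>X - {z}. a i k \<noteq> 0} + card ?D"
    using card_Un_le[of "{i \<in> I. \<exists>k\<in>X - {z}. a i k \<noteq> 0}" ?D] by simp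
  ultimately show ?thesis by simp
qed

section \<open>Elimination of a variable\<close>

text \<open>Gaussian elimination with pivot \<open>a h j\<close>: if the pivot is nonzero, the
  coefficient of \<open>j\<close> becomes 0 and an equation in \<open>X - {j}\<close>
  remains.\<close>

definition elim_coeff :: "('i \<Rightarrow> nat \<Rightarrow> real) \<Rightarrow> 'i \<Rightarrow> nat \<Rightarrow> 'i \<Rightarrow> nat \<Rightarrow> real" where
  "elim_coeff a h j i k = a i k - a i j / a h j * a h k"

definition elim_rhs :: "('i \<Rightarrow> nat \<Rightarrow> real) \<Rightarrow> ('i \<Rightarrow> real) \<Rightarrow> 'i \<Rightarrow> nat \<Rightarrow> 'i \<Rightarrow> real" where
  "elim_rhs a b h j i = b i - a i j / a h j * b h"

lemma sols_elim:
  assumes "finite X" "j \<in> X" "a h j \<noteq> 0" "(\<Sum>k\<in>X. a h k * x k) = b h"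
  shows "sols (elim_coeff a h j) (elim_rhs a b h j) (X - {j}) T x \<longleftrightarrow> sols a b X T x"
proof -
  have "(\<Sum>k\<in>X - {j}. elim_coeff a h j i k * x k) = (\<Sum>k\<in>X. a i k * x k) - a i j / a h j * b h" for i
  proof -
    have "(\<Sum>k\<in>X - {j}. elim_coeff a h j i k * x k) = (\<Sum>k\<in>X. elim_coeff a h j i k * x k)"
      using assms by (simp add: elim_coeff_def sum.remove[of X j])
    also have "\<dots> = (\<Sum>k\<in>X. a i k * x k - a i j / a h j * (a h k * x k))"
      by (intro sum.cong) (auto simp: elim_coeff_def algebra_simps)
    also have "\<dots> = (\<Sum>k\<in>X. a i k * x k) - a i j / a h j * (\<Sum>k\<in>X. a h k * x k)"
      by (simp only: sum_subtractf sum_distrib_left)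
    finally show ?thesis using assms by simp
  qed
  then show ?thesis by (simp add: sols_def elim_rhs_def)
qed

lemma sols_cong: "(\<And>k. k \<in> X \<Longrightarrow> x k = y k) \<Longrightarrow> sols a b X T x \<longleftrightarrow> sols a b X T y"
  by (simp add: sols_def cong: sum.cong)

lemma elim_extend:
  assumes "finite X" "j \<in> X" "a h j \<noteq> 0"
    and x: "sols (elim_coeff a h j) (elim_rhs a b h j) (X - {j}) T x"
  shows "\<exists>y. (\<forall>k\<in>X - {j}. y k = x k) \<and> sols a b X (insert h T) y"
proof -
  \<comment> \<open>The value at \<open>j\<close> is the one that solves the pivot equation
    \<open>h\<close>.\<close>
  define y where "y = x(j := (b h - (\<Sum>k\<in>X - {j}. a h k * x k)) / a h j)"
  have yx: "\<forall>k\<in>X - {j}. y k = x k" by (auto simp: y_def)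
  have "(\<Sum>k\<in>X. a h k * y k) = a h j * y j + (\<Sum>k\<in>X - {j}. a h k * y k)"
    using assms by (simp add: sum.remove)
  also have "(\<Sum>k\<in>X - {j}. a h k * y k) = (\<Sum>k\<in>X - {j}. a h k * x k)"
    using yx by simp
  finally have hy: "(\<Sum>k\<in>X. a h k * y k) = b h"
    using assms by (simp add: y_def)
  have "sols (elim_coeff a h j) (elim_rhs a b h j) (X - {j}) T y"
    using x yx sols_cong[of "X - {j}" y x] by blast
  then have "sols a b X (insert h T) y"
    using sols_elim[of X j a h y b, OF assms(1-3) hy] hy by (simp add: sols_insert)
  with yx show ?thesis by blast
qed

lemma elim_restrict:
  assumes "finite X" "j \<in> X" "a h j \<noteq> 0" "sols a b X (insert h T) x"
  shows "sols (elim_coeff a h j) (elim_rhs a b h j) (X - {j}) T x"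
  using assms sols_elim[of X j a h x b T] by (simp add: sols_insert)

lemma card_insert_elim:
  assumes "finite X" "j \<in> X" "T \<subseteq> I - {h}" "finite I" "card T = m + card (X - {j})"
  shows "card (insert h T) = m + card X"
proof -
  have "finite T" using assms by (meson finite_Diff finite_subset)
  moreover have "card X > 0" using assms card_gt_0_iff by blast
  ultimately show ?thesis using assms by (subst card_insert_disjoint) auto
qed

text \<open>\<open>elim_restrict\<close> and \<open>elim_extend\<close> match the solutions of the
  reduced system \<open>T\<close> with those of the original system \<open>insert h T\<close>, which
  has one equation and one variable more. Both clauses transfer along this correspondence.\<close>

lemma gen_pos_elim:
  assumes gp: "gen_pos a b X I" and fX: "finite X" and fI: "finite I"
    and h: "h \<in> I" and j: "j \<in> X" "a h j \<noteq> 0"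
  shows "gen_pos (elim_coeff a h j) (elim_rhs a b h j) (X - {j}) (I - {h})"
  unfolding gen_pos_def
proof (intro conjI allI impI; elim conjE)
  let ?s = "sols (elim_coeff a h j) (elim_rhs a b h j) (X - {j})"
  {
    fix T assume T: "T \<subseteq> I - {h}" "card T = card (X - {j})"
    have TI: "insert h T \<subseteq> I" using T h by auto
    have c: "card (insert h T) = card X" using card_insert_elim[OF fX j(1) T(1) fI, of 0] T by simp
    show "\<exists>x. ?s T x"
      using gen_posD(1)[OF gp TI c] elim_restrict[where a=a and b=b, OF fX j] by blast
    fix x y assume "?s T x" "?s T y"
    from elim_extend[where a=a and b=b and h=h, OF fX j this(1)]
      elim_extend[where a=a and b=b and h=h, OF fX j this(2)]
    obtain x' y' where *: "\<forall>k\<in>X - {j}. x' k = x k" "sols a b X (insert h T) x'"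
      "\<forall>k\<in>X - {j}. y' k = y k" "sols a b X (insert h T) y'"
      by (elim exE conjE)
    show "\<forall>k\<in>X - {j}. x k = y k"
      using gen_posD(2)[OF gp TI c *(2,4)] *(1,3) by simp
  }
  fix T x assume T: "T \<subseteq> I - {h}" "card T = Suc (card (X - {j}))"
  have TI: "insert h T \<subseteq> I" using T h by auto
  have c: "card (insert h T) = Suc (card X)"
    using card_insert_elim[OF fX j(1) T(1) fI, of 1] T by simp
  show "\<not> ?s T x"
  proof
    assume "?s T x"
    from elim_extend[where a=a and b=b and h=h, OF fX j this] show False
      using gen_pos_no_sols[OF gp TI c] by blast
  qed
qed

text \<open>Both vertices come from the same solution \<open>x\<close>, whose
  \<open>z\<close>-coordinate survives because \<open>j\<close> differs from
  \<open>z\<close>.\<close>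

lemma side_elim:
  assumes gp: "gen_pos a b X I" and fX: "finite X" and fI: "finite I"
    and h: "h \<in> I" and j: "j \<in> X" "a h j \<noteq> 0" and z: "z \<in> X - {j}"
    and T: "T \<subseteq> I - {h}" "card T = card (X - {j})"
  shows "side (elim_coeff a h j) (elim_rhs a b h j) (X - {j}) z T = side a b X z (insert h T)"
proof -
  have TI: "insert h T \<subseteq> I" using T h by auto
  have c: "card (insert h T) = card X" using card_insert_elim[OF fX j(1) T(1) fI, of 0] T by simp
  obtain x where x: "sols a b X (insert h T) x" using gen_posD(1)[OF gp TI c] by blast
  have "side a b X z (insert h T) = sgn (x z)"
    using side_eq[OF gp TI c x] z by auto
  moreover have "side (elim_coeff a h j) (elim_rhs a b h j) (X - {j}) z T = sgn (x z)"
    using side_eq[OF gen_pos_elim[OF gp fX fI h j] T elim_restrict[where a=a and b=b, OF fX j x] z] .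
  ultimately show ?thesis by simp
qed

section \<open>Two variables\<close>

text \<open>Eliminating \<open>x j\<close> by means of equation \<open>s\<close> leaves
  \<open>?P * x z = ?Q\<close>, so the sign of \<open>x z\<close> is the product of the signs of
  \<open>?P\<close> and \<open>?Q\<close>. Only \<open>a s j\<close> is a divisor;
  \<open>a i j\<close> may vanish.\<close>

lemma side_pair:
  assumes gp: "gen_pos a b {j, z} I" and jz: "j \<noteq> z" and i: "i \<in> I" "s \<in> I" "i \<noteq> s"
    and us: "a s j \<noteq> 0"
  shows "a i z - a i j * (a s z / a s j) \<noteq> 0"
    and "side a b {j, z} z {i, s} =
         sgn (a i z - a i j * (a s z / a s j)) * sgn (b i - a i j * (b s / a s j))"
proof -
  let ?P = "a i z - a i j * (a s z / a s j)" and ?Q = "b i - a i j * (b s / a s j)"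
  have T: "{i, s} \<subseteq> I" "card {i, s} = card {j, z}" using i jz by auto
  obtain x where x: "sols a b {j, z} {i, s} x" using gen_posD(1)[OF gp T] by blast
  then have eqs: "a i j * x j + a i z * x z = b i" "a s j * x j + a s z * x z = b s"
    using jz by (auto simp: sols_def)
  show P: "?P \<noteq> 0"
  proof
    assume P: "?P = 0"
    \<comment> \<open>The shift is along the direction of the line \<open>s\<close>, which for
      \<open>?P = 0\<close> is also parallel to the line \<open>i\<close>; so \<open>y\<close> is a
      second common point.\<close>
    define y where "y = x(j := x j - a s z, z := x z + a s j)"
    have "sols a b {j, z} {i, s} y"
      using eqs P us jz by (auto simp: sols_def y_def field_simps)
    then have "x z = y z" using gen_posD(2)[OF gp T x] by blast
    then show False using us by (simp add: y_def)
  qed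
  have "x j = b s / a s j - a s z / a s j * x z"
    using eqs us by (simp add: field_simps)
  then have "a i j * (b s / a s j - a s z / a s j * x z) + a i z * x z = b i"
    using eqs by simp
  then have Q: "?P * x z = ?Q" by (simp add: algebra_simps)
  have "side a b {j, z} z {i, s} = sgn (x z)"
    using side_eq[OF gp T x] by simp
  moreover have "sgn ?P * sgn ?Q = sgn ?P * sgn ?P * sgn (x z)"
    unfolding Q[symmetric] sgn_mult by (simp only: mult.assoc)
  moreover have "sgn ?P * sgn ?P = 1" using P by (simp add: sgn_if)
  ultimately show "side a b {j, z} z {i, s} = sgn ?P * sgn ?Q" by (metis mult_1)
qed

text \<open>Peeling off the minimal elements of the product order, as in Mirsky's theorem.\<close>

lemma erdos_szekeres:
  fixes \<alpha> \<beta> :: "'i \<Rightarrow> real"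
  assumes "finite A" "inj_on \<alpha> A" "inj_on \<beta> A" "r * s < card A"
  shows "(\<exists>C\<subseteq>A. card C = Suc r \<and> (\<forall>i\<in>C. \<forall>k\<in>C. \<alpha> i < \<alpha> k \<longrightarrow> \<beta> i < \<beta> k)) \<or>
         (\<exists>C\<subseteq>A. card C = Suc s \<and> (\<forall>i\<in>C. \<forall>k\<in>C. \<alpha> i < \<alpha> k \<longrightarrow> \<beta> k < \<beta> i))"
  using assms
proof (induction r arbitrary: A)
  case 0
  then obtain i where "i \<in> A" by fastforce
  then show ?case by (intro disjI1 exI[of _ "{i}"]) auto
next
  case (Suc r)
  define B where "B = {i \<in> A. \<not> (\<exists>k\<in>A. \<alpha> k < \<alpha> i \<and> \<beta> k < \<beta> i)}"
  have anti: "\<forall>i\<in>B. \<forall>k\<in>B. \<alpha> i < \<alpha> k \<longrightarrow> \<beta> k < \<beta> i"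
  proof (intro ballI impI)
    fix i k assume *: "i \<in> B" "k \<in> B" "\<alpha> i < \<alpha> k"
    then have "\<beta> i \<noteq> \<beta> k" using Suc.prems(3) by (auto simp: B_def inj_on_def)
    then show "\<beta> k < \<beta> i" using * by (auto simp: B_def)
  qed
  have BA: "B \<subseteq> A" by (auto simp: B_def)
  show ?case
  proof (cases "s < card B")
    case True
    then obtain C where "C \<subseteq> B" "card C = Suc s"
      by (metis Suc_leI obtain_subset_with_card_n)
    then show ?thesis using anti BA by (intro disjI2 exI[of _ C]) auto
  next
    case False
    have "card (A - B) = card A - card B"
      using BA Suc.prems(1) by (meson card_Diff_subset finite_subset)
    then have "r * s < card (A - B)" using False Suc.prems(4) by simp
    from Suc.IH[OF _ _ _ this] Suc.prems(1) inj_on_subset[OF Suc.prems(2) Diff_subset]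
      inj_on_subset[OF Suc.prems(3) Diff_subset]
    consider
        (up) C where "C \<subseteq> A - B" "card C = Suc r" "\<forall>i\<in>C. \<forall>k\<in>C. \<alpha> i < \<alpha> k \<longrightarrow> \<beta> i < \<beta> k"
      | (down) C where "C \<subseteq> A - B" "card C = Suc s" "\<forall>i\<in>C. \<forall>k\<in>C. \<alpha> i < \<alpha> k \<longrightarrow> \<beta> k < \<beta> i"
      by blast
    then show ?thesis
    proof cases
      case down
      then show ?thesis by blast
    next
      case up
      \<comment> \<open>\<open>c\<close> has the least \<open>\<alpha>\<close> in the increasing set
        \<open>C\<close>, hence also the least \<open>\<beta>\<close>. As \<open>c\<close> is not in
        \<open>B\<close>, some \<open>k\<close> lies below it in both values and prolongs
        \<open>C\<close> downwards.\<close>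
      have fC: "finite C" "C \<noteq> {}" using up by (auto intro: card_ge_0_finite)
      define c where "c = arg_min_on \<alpha> C"
      have c: "c \<in> C" "\<forall>i\<in>C. \<alpha> c \<le> \<alpha> i"
        using arg_min_if_finite[OF fC, of \<alpha>] by (auto simp: c_def not_less)
      then obtain k where k: "k \<in> A" "\<alpha> k < \<alpha> c" "\<beta> k < \<beta> c"
        using up(1) unfolding B_def by blast
      have ge: "\<alpha> c = \<alpha> i \<or> \<alpha> c < \<alpha> i" "\<beta> c \<le> \<beta> i" if "i \<in> C" for i
      proof -
        show a: "\<alpha> c = \<alpha> i \<or> \<alpha> c < \<alpha> i" using c that by fastforce
        have "c = i" if "\<alpha> c = \<alpha> i" 
          using Suc.prems(2) up(1) c(1) \<open>i \<in> C\<close> that by (auto simp: inj_on_def)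
        then show "\<beta> c \<le> \<beta> i" using a up(3) c(1) that by fastforce
      qed
      have below: "\<alpha> k < \<alpha> i \<and> \<beta> k < \<beta> i" if "i \<in> C" for i
        using ge[OF that] k by auto
      then have "k \<notin> C" by blast
      then have "card (insert k C) = Suc (Suc r)" using up fC by simp
      moreover have "\<forall>i\<in>insert k C. \<forall>l\<in>insert k C. \<alpha> i < \<alpha> l \<longrightarrow> \<beta> i < \<beta> l"
        using up(3) below by fastforce
      moreover have "insert k C \<subseteq> A" using up k by auto
      ultimately show ?thesis by blast
    qed
  qed
qed

lemma card_image_two_to_one:
  assumes "finite A" "\<And>x y w. x \<in> A \<Longrightarrow> y \<in> A \<Longrightarrow> w \<in> A \<Longrightarrow> f x = f y \<Longrightarrow> f y = f w \<Longrightarrow> x = y \<or> y = w \<or> x = w"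
  shows "card A \<le> 2 * card (f ` A)"
proof -
  have two: "card {x \<in> A. f x = v} \<le> 2" for v
  proof (rule ccontr)
    assume "\<not> ?thesis"
    then obtain C where C: "C \<subseteq> {x \<in> A. f x = v}" "card C = 3"
      by (metis (no_types, lifting) not_less_eq_eq numeral_2_eq_2 numeral_3_eq_3 obtain_subset_with_card_n)
    then obtain x y w where "C = {x, y, w}" "x \<noteq> y" "y \<noteq> w" "x \<noteq> w"
      by (auto simp: card_3_iff)
    then show False using assms(2)[of x y w] C(1) by auto
  qed
  have "(\<Union>v\<in>f ` A. {x \<in> A. f x = v}) = A" by auto
  then have "card A \<le> (\<Sum>v\<in>f ` A. card {x \<in> A. f x = v})"
    using card_UN_le[of "f ` A" "\<lambda>v. {x \<in> A. f x = v}"] assms(1) by simp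
  also have "\<dots> \<le> (\<Sum>v\<in>f ` A. 2)" by (intro sum_mono two)
  finally show ?thesis by simp
qed

text \<open>Divided by its \<open>j\<close>-coefficient, a line reads
  \<open>x j + \<alpha> * x z = \<beta>\<close>. Two lines meet at
  \<open>x z = (\<beta> i - \<beta> k) / (\<alpha> i - \<alpha> k)\<close>, so where
  \<open>\<beta>\<close> is strictly monotone in \<open>\<alpha>\<close>, all vertices lie on one
  side.\<close>

lemma forces_homogeneous_2:
  assumes n: "2 \<le> n"
  shows "forces_homogeneous TYPE('i) 2 n (4 * n\<^sup>2)"
  unfolding forces_homogeneous_def
proof (intro allI impI; elim conjE)
  fix a :: "'i \<Rightarrow> nat \<Rightarrow> real" and b X z I
  assume fX: "finite X" and X: "card X = 2" and z: "z \<in> X" and fI: "finite I"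
    and N: "4 * n\<^sup>2 \<le> card I" and gp: "gen_pos a b X I"
  obtain j where Xj: "X = {j, z}" "j \<noteq> z"
    using X z by (auto simp: card_2_iff)
  have n2: "4 \<le> n\<^sup>2" using power_mono[OF n, of 2] by simp
  define A where "A = {i \<in> I. a i j \<noteq> 0}"
  have "card I \<le> Suc (card {i \<in> I. \<exists>k\<in>X - {z}. a i k \<noteq> 0})"
    using card_nondegenerate[OF gp fX z fI] X N n2 by simp
  moreover have "X - {z} = {j}" using Xj by auto
  ultimately have cA: "card I \<le> Suc (card A)" by (simp add: A_def)
  have fA: "finite A" and AI: "A \<subseteq> I" using fI by (auto simp: A_def)
  define \<alpha> \<beta> where "\<alpha> = (\<lambda>i. a i z / a i j)" and "\<beta> = (\<lambda>i. b i / a i j)"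
  note gp' = gp[unfolded Xj(1)]
  have \<alpha>\<beta>: "a i z = a i j * \<alpha> i" "b i = a i j * \<beta> i" if "i \<in> A" for i
    using that by (auto simp: A_def \<alpha>_def \<beta>_def)
  have pq: "\<alpha> i \<noteq> \<alpha> k" "side a b X z {i, k} = sgn (\<alpha> i - \<alpha> k) * sgn (\<beta> i - \<beta> k)"
    if "i \<in> A" "k \<in> A" "i \<noteq> k" for i k
  proof -
    have nz: "a i j \<noteq> 0" using that by (simp add: A_def)
    have e: "a i z - a i j * (a k z / a k j) = a i j * (\<alpha> i - \<alpha> k)"
      "b i - a i j * (b k / a k j) = a i j * (\<beta> i - \<beta> k)"
      using \<alpha>\<beta>[OF that(1)] by (simp_all add: \<alpha>_def[symmetric] \<beta>_def[symmetric] right_diff_distrib)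
        (simp_all add: \<alpha>_def \<beta>_def)
    have sp: "a i z - a i j * (a k z / a k j) \<noteq> 0"
      "side a b X z {i, k} =
         sgn (a i z - a i j * (a k z / a k j)) * sgn (b i - a i j * (b k / a k j))"
      using side_pair[OF gp' Xj(2), of i k] that AI unfolding Xj(1) by (auto simp: A_def)
    show "\<alpha> i \<noteq> \<alpha> k" using sp(1) e(1) by auto
    have "sgn (a i j) * sgn (a i j) = 1" using nz by (simp add: sgn_if)
    then show "side a b X z {i, k} = sgn (\<alpha> i - \<alpha> k) * sgn (\<beta> i - \<beta> k)"
      unfolding sp(2) e sgn_mult by (simp add: mult.left_commute[of _ "sgn (a i j)"] mult.assoc[symmetric])
  qed
  text \<open>Three equations with the same \<open>\<beta>\<close> have the common solution \<open>x\<^sub>j = \<beta>\<close>, \<open>x\<^sub>z = 0\<close>.\<close>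
  have "card A \<le> 2 * card (\<beta> ` A)"
  proof (rule card_image_two_to_one[OF fA], rule ccontr)
    fix x y w assume A: "x \<in> A" "y \<in> A" "w \<in> A" and eq: "\<beta> x = \<beta> y" "\<beta> y = \<beta> w"
      and ne: "\<not> (x = y \<or> y = w \<or> x = w)"
    have "sols a b X {x, y, w} ((\<lambda>_. 0)(j := \<beta> x))"
      using \<alpha>\<beta>[OF A(1)] \<alpha>\<beta>[OF A(2)] \<alpha>\<beta>[OF A(3)] eq Xj by (simp add: sols_def)
    moreover have "card {x, y, w} = Suc (card X)" using ne X by auto
    ultimately show False
      using gen_pos_no_sols[OF gp, of "{x, y, w}"] A AI by blast
  qed
  \<comment> \<open>At most one line was discarded and at most two share a value of
    \<open>\<beta>\<close>; half of \<open>4 * n^2 - 1\<close> still exceeds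
    \<open>(n - 1)^2\<close>.\<close>
  then have big: "(n - 1) * (n - 1) < card (\<beta> ` A)"
    using cA N n2 by (simp add: power2_eq_square algebra_simps diff_mult_distrib)
  \<comment> \<open>One line is kept for each value of \<open>\<beta>\<close>, to make
    \<open>\<beta>\<close> injective.\<close>
  obtain B where B: "B \<subseteq> A" "inj_on \<beta> B" "\<beta> ` B = \<beta> ` A"
    using subset_image_inj[of "\<beta> ` A" \<beta> A] by auto
  have inj\<alpha>: "inj_on \<alpha> B" using pq(1) B(1) by (meson inj_onI subsetD)
  have "(n - 1) * (n - 1) < card B" using big B by (metis card_image)
  note es = erdos_szekeres[OF finite_subset[OF B(1) fA] inj\<alpha> B(2) this]
  have "Suc (n - 1) = n" using n by simp
  with es consider (up) C where "C \<subseteq> B" "card C = n" "\<forall>i\<in>C. \<forall>k\<in>C. \<alpha> i < \<alpha> k \<longrightarrow> \<beta> i < \<beta> k"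
    | (down) C where "C \<subseteq> B" "card C = n" "\<forall>i\<in>C. \<forall>k\<in>C. \<alpha> i < \<alpha> k \<longrightarrow> \<beta> k < \<beta> i"
    by auto
  then show "\<exists>K\<subseteq>I. card K = n \<and> homogeneous a b X z K"
  proof cases
    case up
    have "side a b X z T = 1" if T: "T \<subseteq> C" "card T = card X" for T
    proof -
      obtain i k where ik: "T = {i, k}" "i \<noteq> k" using T X by (auto simp: card_2_iff)
      then have m: "i \<in> A" "k \<in> A" "i \<in> C" "k \<in> C" using T up B by auto
      have "\<alpha> i < \<alpha> k \<or> \<alpha> k < \<alpha> i" using pq(1)[OF m(1,2) ik(2)] by linarith
      then have "\<alpha> i < \<alpha> k \<and> \<beta> i < \<beta> k \<or> \<alpha> k < \<alpha> i \<and> \<beta> k < \<beta> i" using up(3) m by blast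
      then show ?thesis
        unfolding ik(1) pq(2)[OF m(1,2) ik(2)] by auto
    qed
    then show ?thesis using up B AI by (intro exI[of _ C]) (auto simp: homogeneous_def)
  next
    case down
    have "side a b X z T = -1" if T: "T \<subseteq> C" "card T = card X" for T
    proof -
      obtain i k where ik: "T = {i, k}" "i \<noteq> k" using T X by (auto simp: card_2_iff)
      then have m: "i \<in> A" "k \<in> A" "i \<in> C" "k \<in> C" using T down B by auto
      have "\<alpha> i < \<alpha> k \<or> \<alpha> k < \<alpha> i" using pq(1)[OF m(1,2) ik(2)] by linarith
      then have "\<alpha> i < \<alpha> k \<and> \<beta> k < \<beta> i \<or> \<alpha> k < \<alpha> i \<and> \<beta> i < \<beta> k" using down(3) m by blast
      then show ?thesis
        unfolding ik(1) pq(2)[OF m(1,2) ik(2)] by auto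
    qed
    then show ?thesis using down B AI by (intro exI[of _ C]) (auto simp: homogeneous_def)
  qed
qed

section \<open>Reducing the dimension\<close>

lemma pigeonhole_fibre:
  assumes "finite S" "card (g ` S) * m < card S"
  shows "\<exists>v. m < card {s \<in> S. g s = v}"
proof (rule ccontr)
  assume "\<not> ?thesis"
  then have le: "card {s \<in> S. g s = v} \<le> m" for v by (simp add: not_less)
  have "(\<Union>v\<in>g ` S. {s \<in> S. g s = v}) = S" by auto
  then have "card S \<le> (\<Sum>v\<in>g ` S. card {s \<in> S. g s = v})"
    using card_UN_le[of "g ` S" "\<lambda>v. {s \<in> S. g s = v}"] assms(1) by simp
  also have "\<dots> \<le> (\<Sum>v\<in>g ` S. m)" by (intro sum_mono le)
  finally show False using assms(2) by simp
qed

text \<open>\<open>f ps\<close> classifies the candidates that remain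
  after the elements of \<open>ps\<close> have been picked.\<close>

lemma end_homogeneous_list:
  fixes f :: "'a list \<Rightarrow> 'a \<Rightarrow> 'c"
  assumes fA: "finite A"
    and Q: "\<And>ps. set ps \<subseteq> A \<Longrightarrow> length ps \<le> L \<Longrightarrow> card (f ps ` A) \<le> Q"
  shows "set ps \<subseteq> A \<Longrightarrow> length ps + m \<le> L \<Longrightarrow> S \<subseteq> A \<Longrightarrow> (Q + 1) ^ m \<le> card S \<Longrightarrow>
    \<exists>ys. length ys = m \<and> distinct ys \<and> set ys \<subseteq> S \<and>
      (\<forall>i j k. i < j \<longrightarrow> j < m \<longrightarrow> i < k \<longrightarrow> k < m \<longrightarrow>
         f (ps @ take (Suc i) ys) (ys ! j) = f (ps @ take (Suc i) ys) (ys ! k))"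
proof (induction m arbitrary: ps S)
  case 0
  then show ?case by auto
next
  case (Suc m)
  have fS: "finite S" using fA Suc.prems by (auto intro: finite_subset)
  have pos: "(Q + 1) ^ Suc m > 0" by simp
  then have "S \<noteq> {}" using Suc.prems(4) by (metis card.empty not_less)
  then obtain y where y: "y \<in> S" by auto
  let ?g = "f (ps @ [y])"
  have ps: "set (ps @ [y]) \<subseteq> A" "length (ps @ [y]) + m \<le> L"
    using Suc.prems y by auto
  have "card (?g ` A) \<le> Q" using Q[OF ps(1)] ps(2) by simp
  moreover have "card (?g ` (S - {y})) \<le> card (?g ` A)"
    using Suc.prems(3) fA by (intro card_mono) auto
  moreover have "card (?g ` A) > 0" using y Suc.prems(3) fA by (auto simp: card_gt_0_iff)
  ultimately have q: "card (?g ` (S - {y})) \<le> Q" "0 < Q" by auto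
  \<comment> \<open>The pick \<open>y\<close> leaves the pool before the pigeonhole step, so the
    strict inequality is needed with 1 subtracted from both powers; this is where
    \<open>0 < Q\<close> enters.\<close>
  have "card (?g ` (S - {y})) * ((Q + 1) ^ m - 1) \<le> Q * ((Q + 1) ^ m - 1)"
    using q(1) by (rule mult_le_mono1)
  also have "\<dots> < (Q + 1) ^ Suc m - 1"
  proof -
    obtain p where "(Q + 1) ^ m = Suc p" using not0_implies_Suc[of "(Q + 1) ^ m"] by auto
    then show ?thesis using q(2) by simp
  qed
  also have "\<dots> \<le> card (S - {y})" using Suc.prems(4) y fS by simp
  finally have "\<exists>v. (Q + 1) ^ m - 1 < card {s \<in> S - {y}. ?g s = v}"
    by (intro pigeonhole_fibre) (use fS in auto)
  then obtain v where v: "(Q + 1) ^ m - 1 < card {s \<in> S - {y}. ?g s = v}" by blast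
  let ?T = "{s \<in> S - {y}. ?g s = v}"
  have "?T \<subseteq> A" "(Q + 1) ^ m \<le> card ?T" using Suc.prems(3) v by auto
  from Suc.IH[OF ps this] obtain ys where ys: "length ys = m" "distinct ys" "set ys \<subseteq> ?T"
    "\<forall>i j k. i < j \<longrightarrow> j < m \<longrightarrow> i < k \<longrightarrow> k < m \<longrightarrow>
         f ((ps @ [y]) @ take (Suc i) ys) (ys ! j) = f ((ps @ [y]) @ take (Suc i) ys) (ys ! k)"
    by blast
  show ?case
  proof (intro exI[of _ "y # ys"] conjI allI impI)
    fix i j k assume *: "i < j" "j < Suc m" "i < k" "k < Suc m"
    then obtain j' k' where jk: "j = Suc j'" "k = Suc k'" by (meson less_imp_Suc_add)
    have mem: "ys ! j' \<in> ?T" "ys ! k' \<in> ?T"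
      using * jk ys(1,3) by (meson Suc_less_SucD nth_mem subsetD)+
    show "f (ps @ take (Suc i) (y # ys)) ((y # ys) ! j) = f (ps @ take (Suc i) (y # ys)) ((y # ys) ! k)"
    proof (cases i)
      case 0
      then show ?thesis using mem jk by simp
    next
      case (Suc i')
      then show ?thesis using ys(4)[rule_format, of i' j' k'] * jk by simp
    qed
  qed (use ys y in auto)
qed

text \<open>By \<open>coh\<close>, the hyperplane of largest index in a vertex can be exchanged for
  the last one, \<open>h = ys ! M\<close>, without changing the side. All sides are then read off
  inside \<open>h\<close>, where the other \<open>M\<close> hyperplanes form an arrangement in
  \<open>d\<close> variables to which \<open>forces\<close> applies.\<close>

lemma homogeneous_of_end_homogeneous:
  fixes a :: "'i \<Rightarrow> nat \<Rightarrow> real"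
  assumes forces: "forces_homogeneous TYPE('i) d n M"
    and fX: "finite X" and cX: "card X = Suc d" and z: "z \<in> X" and fI: "finite I"
    and gp: "gen_pos a b X I"
    and ys: "length ys = Suc M" "distinct ys" "set ys \<subseteq> I"
    and j: "j \<in> X - {z}" "a (ys ! M) j \<noteq> 0"
    and coh: "\<And>J p q. J \<subseteq> {..<M} \<Longrightarrow> card J = d \<Longrightarrow> \<forall>i\<in>J. i < p \<and> i < q \<Longrightarrow> p \<le> M \<Longrightarrow> q \<le> M \<Longrightarrow>
      side a b X z (insert (ys ! p) ((!) ys ` J)) = side a b X z (insert (ys ! q) ((!) ys ` J))"
  shows "\<exists>K\<subseteq>I. card K = n \<and> homogeneous a b X z K"
proof -
  define h where "h = ys ! M"
  define I0 where "I0 = (!) ys ` {..<M}"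
  have inj: "inj_on ((!) ys) {..M}"
    using ys by (auto simp: inj_on_def nth_eq_iff_index_eq)
  have hI: "h \<in> I" using ys by (auto simp: h_def)
  have I0: "I0 \<subseteq> I - {h}"
    using ys by (auto simp: I0_def h_def nth_eq_iff_index_eq)
  have "card I0 = M"
    unfolding I0_def by (subst card_image) (auto intro: inj_on_subset[OF inj])
  have jX: "j \<in> X" and hj: "a h j \<noteq> 0" and zj: "z \<in> X - {j}" using j z by (auto simp: h_def)
  have cX': "card (X - {j}) = d" using cX jX fX by simp
  note gp' = gen_pos_subset[OF gen_pos_elim[OF gp fX fI hI jX hj] I0]
  have "finite (X - {j})" "finite I0" using fX by (auto simp: I0_def)
  with forces[unfolded forces_homogeneous_def] obtain K where
    K: "K \<subseteq> I0" "card K = n" "homogeneous (elim_coeff a h j) (elim_rhs a b h j) (X - {j}) z K"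
    using cX' zj \<open>card I0 = M\<close> gp' by (metis order_refl)
  then obtain s where s: "s \<in> {1, -1}"
    "\<forall>T. T \<subseteq> K \<and> card T = d \<longrightarrow> side (elim_coeff a h j) (elim_rhs a b h j) (X - {j}) z T = s"
    unfolding homogeneous_def cX' by blast
  have "side a b X z T = s" if T: "T \<subseteq> K" "card T = Suc d" for T
  proof -
    obtain B where B: "B \<subseteq> {..<M}" "T = (!) ys ` B"
      using T K by (metis I0_def subset_trans subset_imageE)
    have injB: "inj_on ((!) ys) B" using B(1) by (intro inj_on_subset[OF inj]) auto
    have fB: "finite B" using B(1) finite_subset by blast
    have cB: "card B = Suc d" using T(2) B(2) card_image[OF injB] by simp
    then have "B \<noteq> {}" by auto
    \<comment> \<open>\<open>p\<close> is the index exchanged for \<open>M\<close>; the set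
      \<open>J\<close> of the other \<open>d\<close> indices determines a vertex inside
      \<open>h\<close>.\<close>
    define p J where "p = Max B" and "J = B - {p}"
    have p: "p \<in> B" "\<forall>i\<in>B. i \<le> p" using fB \<open>B \<noteq> {}\<close> by (auto simp: p_def)
    have J: "J \<subseteq> {..<M}" "card J = d" "\<forall>i\<in>J. i < p \<and> i < M" "p \<le> M"
      using p B(1) cB fB by (auto simp: J_def order.not_eq_order_implies_strict)
    have TJ: "T = insert (ys ! p) ((!) ys ` J)" using B(2) p(1) by (auto simp: J_def)
    have sub: "(!) ys ` J \<subseteq> T" using TJ by auto
    have "card ((!) ys ` J) = d"
      using J(2) inj_on_subset[OF injB, of J] by (subst card_image) (auto simp: J_def)
    then have J': "(!) ys ` J \<subseteq> I - {h}" "card ((!) ys ` J) = card (X - {j})" "(!) ys ` J \<subseteq> K"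
      using sub T K I0 cX' by auto
    have "side a b X z T = side a b X z (insert h ((!) ys ` J))"
      unfolding TJ h_def by (rule coh[OF J]) simp
    also have "\<dots> = side (elim_coeff a h j) (elim_rhs a b h j) (X - {j}) z ((!) ys ` J)"
      using side_elim[OF gp fX fI hI jX hj zj J'(1,2)] by simp
    also have "\<dots> = s" using s(2) J' cX' by simp
    finally show ?thesis .
  qed
  then have "homogeneous a b X z K"
    using s(1) cX by (auto simp: homogeneous_def)
  then show ?thesis using K I0 by blast
qed

text \<open>A candidate is classified by its sides together with all \<open>d\<close>-subsets of the
  picked elements. There are at most \<open>Suc M ^ d\<close> such subsets and three signs for each,
  which gives the base of the power. The summand \<open>d + 2\<close> ensures
  \<open>card X < card I\<close> and pays for one degenerate equation.\<close>

lemma forces_homogeneous_Suc: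
  assumes forces: "forces_homogeneous TYPE('i) d n M" and d: "0 < d"
  shows "forces_homogeneous TYPE('i) (Suc d) n ((3 ^ (Suc M ^ d) + 1) ^ Suc M + d + 2)"
  unfolding forces_homogeneous_def
proof (intro allI impI; elim conjE)
  fix a :: "'i \<Rightarrow> nat \<Rightarrow> real" and b X z I
  assume fX: "finite X" and cX: "card X = Suc d" and z: "z \<in> X" and fI: "finite I"
    and N: "(3 ^ (Suc M ^ d) + 1) ^ Suc M + d + 2 \<le> card I" and gp: "gen_pos a b X I"
  define A where "A = {i \<in> I. \<exists>k\<in>X - {z}. a i k \<noteq> 0}"
  have "card I \<le> Suc (card A)"
    unfolding A_def using card_nondegenerate[OF gp fX z fI] cX N d by simp
  then have cA: "(3 ^ (Suc M ^ d) + 1) ^ Suc M \<le> card A" using N by simp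
  have AI: "A \<subseteq> I" and fA: "finite A" using fI by (auto simp: A_def)
  \<comment> \<open>\<open>restrict\<close> makes each class an extensional function, so that
    classes are counted by a finite product. The sign 0 has to be counted, as a vertex may have
    \<open>z\<close>-coordinate 0.\<close>
  define f where "f = (\<lambda>ps s. restrict (\<lambda>J. side a b X z (insert s J)) {J. J \<subseteq> set ps \<and> card J = d})"
  have Q: "card (f ps ` A) \<le> 3 ^ (Suc M ^ d)" if "length ps \<le> Suc M" for ps :: "'i list"
  proof -
    let ?D = "{J. J \<subseteq> set ps \<and> card J = d}"
    have cV: "card {-1, 0, 1::real} = 3" by simp
    have fD: "finite ?D" by simp
    have "card (set ps) \<le> Suc M" using that card_length le_trans by blast
    then have "card ?D \<le> Suc M choose d"
      by (simp add: n_subsets binomial_right_mono)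
    also have "\<dots> \<le> Suc M ^ d"
      by (cases "d \<le> Suc M") (auto intro: binomial_le_pow simp: binomial_eq_0)
    finally have D: "card ?D \<le> Suc M ^ d" .
    have "f ps ` A \<subseteq> (\<Pi>\<^sub>E J\<in>?D. {-1, 0, 1})"
      unfolding f_def by (intro image_subsetI restrict_PiE_iff[THEN iffD2] ballI side_values)
    then have "card (f ps ` A) \<le> card (\<Pi>\<^sub>E J\<in>?D. {-1, 0, 1::real})"
      using fD by (intro card_mono finite_PiE) auto
    also have "\<dots> = 3 ^ card ?D" using fD by (simp add: card_PiE cV del: insert_iff)
    also have "\<dots> \<le> 3 ^ (Suc M ^ d)" using D by (intro power_increasing) auto
    finally show ?thesis .
  qed
  have "set [] \<subseteq> A" "length ([] :: 'i list) + Suc M \<le> Suc M" by simp_all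
  from end_homogeneous_list[of A "Suc M" f, OF fA Q this order_refl cA]
  obtain ys where ys: "length ys = Suc M" "distinct ys" "set ys \<subseteq> A"
    "\<And>i j k. i < j \<Longrightarrow> j < Suc M \<Longrightarrow> i < k \<Longrightarrow> k < Suc M \<Longrightarrow>
       f (take (Suc i) ys) (ys ! j) = f (take (Suc i) ys) (ys ! k)"
    unfolding append_Nil by blast
  have "ys ! M \<in> A" using ys by auto
  then obtain j where j: "j \<in> X - {z}" "a (ys ! M) j \<noteq> 0" by (auto simp: A_def)
  show "\<exists>K\<subseteq>I. card K = n \<and> homogeneous a b X z K"
  proof (rule homogeneous_of_end_homogeneous[OF forces fX cX z fI gp ys(1,2) subset_trans[OF ys(3) AI] j])
    fix J p q assume J: "J \<subseteq> {..<M}" "card J = d" "\<forall>i\<in>J. i < p \<and> i < q" "p \<le> M" "q \<le> M"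
    have fJ: "finite J" "J \<noteq> {}" using J d by (auto intro: finite_subset)
    \<comment> \<open>Right after the pick \<open>ys ! i\<close> with \<open>i = Max J\<close>, all
      of \<open>J\<close> has been picked, while \<open>p\<close> and \<open>q\<close> are still to
      come and hence share a class.\<close>
    define i where "i = Max J"
    have i: "i \<in> J" "\<forall>k\<in>J. k \<le> i" using fJ by (auto simp: i_def)
    have "(!) ys ` J \<subseteq> set (take (Suc i) ys)"
    proof
      fix y assume "y \<in> (!) ys ` J"
      then obtain k where k: "k \<in> J" "y = ys ! k" by auto
      then have "k < Suc i" "k < length ys" using i J ys(1) by (auto simp: less_Suc_eq_le)
      then have "take (Suc i) ys ! k \<in> set (take (Suc i) ys)" by (intro nth_mem) simp
      then show "y \<in> set (take (Suc i) ys)" using k \<open>k < Suc i\<close> by simp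
    qed
    moreover have "card ((!) ys ` J) = d"
    proof -
      have "\<forall>i\<in>J. i < length ys" using J(1) ys(1) by auto
      then have "inj_on ((!) ys) J" using ys(2) by (simp add: inj_on_def nth_eq_iff_index_eq)
      then show ?thesis using J by (simp add: card_image)
    qed
    moreover have "f (take (Suc i) ys) (ys ! p) = f (take (Suc i) ys) (ys ! q)"
      using J i by (intro ys(4)) auto
    then have "f (take (Suc i) ys) (ys ! p) ((!) ys ` J) = f (take (Suc i) ys) (ys ! q) ((!) ys ` J)"
      by simp
    ultimately show "side a b X z (insert (ys ! p) ((!) ys ` J)) = side a b X z (insert (ys ! q) ((!) ys ` J))"
      by (simp add: f_def)
  qed
qed

section \<open>Three variables\<close>

text \<open>As \<open>t\<close> varies, the sets in each component are nested, so a cut is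
  determined by the sizes of its two components, each between 0 and \<open>card F\<close>.\<close>

lemma card_cuts:
  fixes g :: "'i \<Rightarrow> real"
  assumes "finite F"
  shows "finite ((\<lambda>t. ({i \<in> F. g i < t}, {i \<in> F. g i \<le> t})) ` U)"
    and "card ((\<lambda>t. ({i \<in> F. g i < t}, {i \<in> F. g i \<le> t})) ` U) \<le> (card F + 1)\<^sup>2"
proof -
  let ?c = "\<lambda>t. ({i \<in> F. g i < t}, {i \<in> F. g i \<le> t})"
  have "?c ` U \<subseteq> Pow F \<times> Pow F" by auto
  then show "finite (?c ` U)" using assms by (meson finite_Pow_iff finite_SigmaI finite_subset)
  have "inj_on (map_prod card card) (?c ` U)"
  proof (rule inj_onI, clarify)
    fix s t assume eq: "map_prod card card (?c s) = map_prod card card (?c t)"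
    have eqI: "A = B" if "A \<subseteq> B \<or> B \<subseteq> A" "card A = card B" "A \<subseteq> F" "B \<subseteq> F" for A B
      using that assms by (metis card_subset_eq finite_subset)
    have sub: "{i \<in> F. g i < s} \<subseteq> {i \<in> F. g i < t} \<or> {i \<in> F. g i < t} \<subseteq> {i \<in> F. g i < s}"
      "{i \<in> F. g i \<le> s} \<subseteq> {i \<in> F. g i \<le> t} \<or> {i \<in> F. g i \<le> t} \<subseteq> {i \<in> F. g i \<le> s}"
      by (cases "s \<le> t"; auto)+
    have crd: "card {i \<in> F. g i < s} = card {i \<in> F. g i < t}" "card {i \<in> F. g i \<le> s} = card {i \<in> F. g i \<le> t}"
      using eq by simp_all
    show "{i \<in> F. g i < s} = {i \<in> F. g i < t} \<and> {i \<in> F. g i \<le> s} = {i \<in> F. g i \<le> t}"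
      using eqI[OF sub(1) crd(1)] eqI[OF sub(2) crd(2)] by blast
  qed
  moreover have "card {i \<in> F. P i} \<le> card F" for P
    using assms by (intro card_mono) auto
  then have "map_prod card card ` ?c ` U \<subseteq> {..card F} \<times> {..card F}"
    by (intro subsetI) auto
  ultimately have "card (?c ` U) \<le> card ({..card F} \<times> {..card F})"
    by (rule card_inj_on_le) simp
  then show "card (?c ` U) \<le> (card F + 1)\<^sup>2" by (simp add: power2_eq_square)
qed

lemma sgn_diff_eq_of_cuts:
  fixes g :: "'i \<Rightarrow> real"
  assumes "({i \<in> F. g i < s}, {i \<in> F. g i \<le> s}) = ({i \<in> F. g i < t}, {i \<in> F. g i \<le> t})" "i \<in> F"
  shows "sgn (g i - s) = sgn (g i - t)"
proof -
  have "g i < s \<longleftrightarrow> g i < t" "g i \<le> s \<longleftrightarrow> g i \<le> t" using assms by auto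
  then show ?thesis by (auto simp: sgn_if)
qed

text \<open>Within a fixed plane, a line \<open>s\<close> is classified by the positions of its two coefficients among
  those of the finitely many lines \<open>F\<close>; the number of classes is polynomial in \<open>card F\<close>.
  Lines with vanishing \<open>j\<close>-coefficient, of which general position admits only one, form their own class.\<close>

definition line_class ::
  "('i \<Rightarrow> nat \<Rightarrow> real) \<Rightarrow> ('i \<Rightarrow> real) \<Rightarrow> nat \<Rightarrow> nat \<Rightarrow> 'i set \<Rightarrow> 'i \<Rightarrow>
     (('i set \<times> 'i set) \<times> ('i set \<times> 'i set)) option" where
  "line_class a b j z F s =
     (if a s j = 0 then None else
      Some (({i \<in> F. a i z / a i j < a s z / a s j}, {i \<in> F. a i z / a i j \<le> a s z / a s j}),
            ({i \<in> F. b i / a i j < b s / a s j}, {i \<in> F. b i / a i j \<le> b s / a s j})))"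

lemma card_line_class:
  assumes "finite F"
  shows "card (line_class a b j z F ` A) \<le> (card F + 1) ^ 4 + 1"
proof -
  let ?C = "\<lambda>g. range (\<lambda>t. ({i \<in> F. g i < t}, {i \<in> F. g i \<le> (t::real)}))"
  let ?P = "?C (\<lambda>i. a i z / a i j) \<times> ?C (\<lambda>i. b i / a i j)"
  have fP: "finite ?P" using card_cuts(1)[OF assms] by (intro finite_SigmaI)
  have "line_class a b j z F ` A \<subseteq> insert None (Some ` ?P)"
    by (auto simp: line_class_def)
  then have "card (line_class a b j z F ` A) \<le> card (insert None (Some ` ?P))"
    using fP by (intro card_mono) auto
  also have "\<dots> \<le> card ?P + 1"
    using fP by (simp add: card_insert_if card_image)
  also have "card ?P \<le> (card F + 1)\<^sup>2 * (card F + 1)\<^sup>2"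
    unfolding card_cartesian_product by (intro mult_le_mono card_cuts(2)[OF assms])
  also have "(card F + 1)\<^sup>2 * (card F + 1)\<^sup>2 = (card F + 1) ^ 4"
    by (simp only: power_add[symmetric]) simp
  finally show ?thesis by simp
qed

text \<open>By \<open>side_pair\<close>, the side depends only on how the two normalised
  coefficients of \<open>s\<close> compare with those of \<open>i\<close>, which the class records.
  In the class \<open>None\<close> both lines are degenerate and therefore equal.\<close>

lemma side_eq_of_line_class:
  assumes gp: "gen_pos a b {j, z} I" and jz: "j \<noteq> z" and fI: "finite I" and big: "2 < card I"
    and F: "F \<subseteq> I" and i: "i \<in> F" "s \<in> I" "t \<in> I" "s \<noteq> i" "t \<noteq> i"
    and eq: "line_class a b j z F s = line_class a b j z F t"
  shows "side a b {j, z} z {i, s} = side a b {j, z} z {i, t}"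
proof (cases "a s j = 0")
  case True
  then have "a t j = 0" using eq by (auto simp: line_class_def split: if_splits)
  then have "s = t"
    using unique_degenerate_equation[OF gp _ _ fI, of z s t] True jz big i by auto
  then show ?thesis by simp
next
  case False
  then have t: "a t j \<noteq> 0" using eq by (auto simp: line_class_def split: if_splits)
  have sg: "sgn (a i z - a i j * (a s z / a s j)) = sgn (a i z - a i j * (a t z / a t j))"
    "sgn (b i - a i j * (b s / a s j)) = sgn (b i - a i j * (b t / a t j))" 
  proof -
    \<comment> \<open>For \<open>a i j = 0\<close> the subtracted terms vanish, so the quotient by
      zero in the cuts does no harm.\<close>
    have *: "sgn (c - a i j * u) = sgn (c - a i j * v)" 
      if "sgn (c / a i j - u) = sgn (c / a i j - v)" for c u v
    proof (cases "a i j = 0")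
      case nz: False
      have "c - a i j * w = a i j * (c / a i j - w)" for w using nz by (simp add: field_simps)
      then show ?thesis using that by (simp add: sgn_mult)
    qed simp
    have cuts: "({i \<in> F. a i z / a i j < a s z / a s j}, {i \<in> F. a i z / a i j \<le> a s z / a s j}) =
       ({i \<in> F. a i z / a i j < a t z / a t j}, {i \<in> F. a i z / a i j \<le> a t z / a t j})"
      "({i \<in> F. b i / a i j < b s / a s j}, {i \<in> F. b i / a i j \<le> b s / a s j}) =
       ({i \<in> F. b i / a i j < b t / a t j}, {i \<in> F. b i / a i j \<le> b t / a t j})"
      using eq False t by (simp_all add: line_class_def)
    show "sgn (a i z - a i j * (a s z / a s j)) = sgn (a i z - a i j * (a t z / a t j))"
      by (rule *, rule sgn_diff_eq_of_cuts[OF cuts(1) i(1)])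
    show "sgn (b i - a i j * (b s / a s j)) = sgn (b i - a i j * (b t / a t j))"
      by (rule *, rule sgn_diff_eq_of_cuts[OF cuts(2) i(1)])
  qed
  have iI: "i \<in> I" using F i by auto
  show ?thesis
    using side_pair(2)[OF gp jz iI i(2) _ False] side_pair(2)[OF gp jz iI i(3) _ t] sg i by simp
qed

text \<open>Of three selected planes, the second is taken as the plane \<open>h\<close> in which the
  first and the third are compared as lines. After each pick, the candidates are therefore
  classified only within the latest plane, against the earlier picks, and
  \<open>(Suc M + 1) ^ 4 + 1\<close> classes suffice.\<close>

lemma forces_homogeneous_3:
  assumes forces: "forces_homogeneous TYPE('i) 2 n M"
  shows "forces_homogeneous TYPE('i) 3 n (((Suc M + 1) ^ 4 + 2) ^ Suc M + 5)"
  unfolding forces_homogeneous_def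
proof (intro allI impI; elim conjE)
  fix a :: "'i \<Rightarrow> nat \<Rightarrow> real" and b X z I
  assume fX: "finite X" and cX: "card X = 3" and z: "z \<in> X" and fI: "finite I"
    and N: "((Suc M + 1) ^ 4 + 2) ^ Suc M + 5 \<le> card I" and gp: "gen_pos a b X I"
  define A where "A = {i \<in> I. \<exists>k\<in>X - {z}. a i k \<noteq> 0}"
  have "card I \<le> Suc (card A)"
    unfolding A_def using card_nondegenerate[OF gp fX z fI] cX N by simp
  then have cA: "((Suc M + 1) ^ 4 + 1 + 1) ^ Suc M \<le> card A" using N by simp
  have AI: "A \<subseteq> I" and fA: "finite A" using fI by (auto simp: A_def)
  have "\<forall>h\<in>A. \<exists>k\<in>X - {z}. a h k \<noteq> 0" by (auto simp: A_def)
  then obtain e where e: "\<And>h. h \<in> A \<Longrightarrow> e h \<in> X - {z} \<and> a h (e h) \<noteq> 0" by metis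
  have "\<exists>k. X - {e h} = {k, z} \<and> k \<noteq> z" if "h \<in> A" for h
  proof -
    have "card (X - {e h} - {z}) = 1" using e[OF that] cX z fX by simp
    then obtain k where "X - {e h} - {z} = {k}" by (meson card_1_singletonE)
    then show ?thesis using e[OF that] z by (intro exI[of _ k]) auto
  qed
  then obtain u where u: "\<And>h. h \<in> A \<Longrightarrow> X - {e h} = {u h, z} \<and> u h \<noteq> z" by metis
  \<comment> \<open>The last pick is the ambient plane, with its own pivot variable
    \<open>e h\<close>; the earlier picks are the lines \<open>F\<close> in it.\<close>
  define f where "f = (\<lambda>ps. let h = last ps in
     line_class (elim_coeff a h (e h)) (elim_rhs a b h (e h)) (u h) z (set (butlast ps)))"
  have Q: "card (f ps ` A) \<le> (Suc M + 1) ^ 4 + 1" if "length ps \<le> Suc M" for ps :: "'i list"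
  proof -
    have "card (set (butlast ps)) \<le> Suc M"
      using card_length[of "butlast ps"] that by simp
    then have "(card (set (butlast ps)) + 1) ^ 4 \<le> (Suc M + 1) ^ 4"
      by (intro power_mono) auto
    moreover have "card (f ps ` A) \<le> (card (set (butlast ps)) + 1) ^ 4 + 1"
      unfolding f_def Let_def by (rule card_line_class) simp
    ultimately show ?thesis by linarith
  qed
  have "set [] \<subseteq> A" "length ([] :: 'i list) + Suc M \<le> Suc M" by simp_all
  from end_homogeneous_list[of A "Suc M" f, OF fA Q this order_refl cA]
  obtain ys where ys: "length ys = Suc M" "distinct ys" "set ys \<subseteq> A"
    "\<And>i j k. i < j \<Longrightarrow> j < Suc M \<Longrightarrow> i < k \<Longrightarrow> k < Suc M \<Longrightarrow>
       f (take (Suc i) ys) (ys ! j) = f (take (Suc i) ys) (ys ! k)"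
    unfolding append_Nil by blast
  have "ys ! M \<in> A" using ys by auto
  then obtain j where j: "j \<in> X - {z}" "a (ys ! M) j \<noteq> 0" by (auto simp: A_def)
  have cX2: "card X = Suc 2" using cX by simp
  show "\<exists>K\<subseteq>I. card K = n \<and> homogeneous a b X z K"
  proof (rule homogeneous_of_end_homogeneous[OF forces fX cX2 z fI gp ys(1,2) subset_trans[OF ys(3) AI] j])
    fix J p q assume J: "J \<subseteq> {..<M}" "card J = 2" "\<forall>i\<in>J. i < p \<and> i < q" "p \<le> M" "q \<le> M"
    obtain i k where ik: "J = {i, k}" "i < k"
      using J(2) by (metis card_2_iff insert_commute linorder_neqE_nat)
    have lt: "k < M" "k < p" "k < q" "i < p" "i < q" using J ik by auto
    define h where "h = ys ! k"
    have hA: "h \<in> A" using ys lt by (auto simp: h_def)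
    have hI: "h \<in> I" using hA AI by auto
    have eX: "e h \<in> X" "a h (e h) \<noteq> 0" "z \<in> X - {e h}" using e[OF hA] z by auto
    let ?a = "elim_coeff a h (e h)" and ?b = "elim_rhs a b h (e h)"
    have gp': "gen_pos ?a ?b {u h, z} (I - {h})"
      using gen_pos_elim[OF gp fX fI hI eX(1,2)] u[OF hA] by simp
    let ?F = "set (take k ys)"
    have tk: "take (Suc k) ys = take k ys @ [h]"
      using lt ys(1) by (simp add: h_def take_Suc_conv_app_nth)
    have "f (take (Suc k) ys) (ys ! p) = f (take (Suc k) ys) (ys ! q)"
      using lt J by (intro ys(4)) auto
    then have cl: "line_class ?a ?b (u h) z ?F (ys ! p) = line_class ?a ?b (u h) z ?F (ys ! q)"
      by (simp add: f_def tk)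
    have mem: "ys ! r \<in> I - {h}" if "r \<le> M" "r \<noteq> k" for r
    proof -
      have "r < length ys" using that ys(1) by simp
      then have "ys ! r \<in> A" using ys(3) nth_mem by blast
      then show ?thesis using that ys(1,2) lt AI by (auto simp: h_def nth_eq_iff_index_eq)
    qed
    have F: "?F \<subseteq> I - {h}"
    proof
      fix y assume "y \<in> ?F"
      then obtain r where "r < k" "y = ys ! r" using ys(1) lt by (auto simp: in_set_conv_nth)
      then show "y \<in> I - {h}" using mem[of r] lt by simp
    qed
    have iF: "ys ! i \<in> ?F" using ik lt ys(1) by (auto simp: in_set_conv_nth intro!: exI[of _ i])
    have ne: "ys ! p \<noteq> ys ! i" "ys ! q \<noteq> ys ! i"
      using ys(1,2) lt J by (auto simp: nth_eq_iff_index_eq)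
    have big: "2 < card (I - {h})" using N hI fI by simp
    have fI': "finite (I - {h})" using fI by simp
    have pI: "ys ! p \<in> I - {h}" and qI: "ys ! q \<in> I - {h}" using mem lt J by auto
    have "side ?a ?b {u h, z} z {ys ! i, ys ! p} = side ?a ?b {u h, z} z {ys ! i, ys ! q}"
      using side_eq_of_line_class[OF gp' _ fI' big F iF pI qI ne cl] u[OF hA] by simp
    moreover have "side ?a ?b {u h, z} z {ys ! i, ys ! r} = side a b X z (insert (ys ! r) ((!) ys ` J))"
      if r: "ys ! r \<in> I - {h}" "ys ! r \<noteq> ys ! i" for r
    proof -
      have "{ys ! i, ys ! r} \<subseteq> I - {h}" "card {ys ! i, ys ! r} = card (X - {e h})"
        using r F iF cX fX eX by auto
      from side_elim[OF gp fX fI hI eX this] u[OF hA]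
      have "side ?a ?b {u h, z} z {ys ! i, ys ! r} = side a b X z (insert h {ys ! i, ys ! r})"
        by simp
      also have "insert h {ys ! i, ys ! r} = insert (ys ! r) ((!) ys ` J)"
        using ik by (auto simp: h_def)
      finally show ?thesis .
    qed
    ultimately show "side a b X z (insert (ys ! p) ((!) ys ` J)) = side a b X z (insert (ys ! q) ((!) ys ` J))"
      using pI qI ne by simp
  qed
qed

section \<open>Tower bounds\<close>

lemma twr_ge_1: "1 \<le> x \<Longrightarrow> 1 \<le> twr i x"
proof (induction i x rule: twr.induct)
  case (3 i x)
  then show ?case by (simp add: ge_one_powr_ge_zero)
qed simp_all

text \<open>Moves a constant factor inside the tower: with \<open>k = Suc m\<close> and
  \<open>1 \<le> t\<close>, \<open>k \<le> 2 powr (m * t)\<close>, so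
  \<open>k * 2 powr t \<le> 2 powr (k * t)\<close>.\<close>

lemma mult_twr_le:
  fixes k :: nat
  assumes k: "1 \<le> k" and x: "1 \<le> x"
  shows "real k * twr (Suc i) x \<le> twr (Suc i) (real k * x)"
proof (induction i)
  case (Suc i)
  let ?t = "twr (Suc i) x"
  have t: "1 \<le> ?t" by (rule twr_ge_1[OF x])
  obtain m where m: "k = Suc m" using k by (cases k) auto
  have "real k \<le> real (2 ^ m)" using less_exp[of m] m by (metis Suc_leI of_nat_mono)
  also have "\<dots> = 2 powr real m" by (simp add: powr_realpow)
  also have "\<dots> \<le> 2 powr (real m * ?t)"
    using mult_left_mono[OF t, of "real m"] by (intro powr_mono) auto
  finally have "real k * 2 powr ?t \<le> 2 powr (real m * ?t) * 2 powr ?t"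
    by (intro mult_right_mono) auto
  also have "\<dots> = 2 powr (real k * ?t)" by (simp add: powr_add[symmetric] m algebra_simps)
  also have "\<dots> \<le> 2 powr twr (Suc i) (real k * x)" using Suc by simp
  finally show ?case by simp
qed simp

text \<open>The bound of \<open>forces_homogeneous_3\<close> for \<open>M = 4 * n^2\<close>. Since
  \<open>2 \<le> n\<close>, every constant is absorbed into a power of \<open>n\<close>: the inner
  base is at most \<open>n ^ 5\<close>, the outer one at most \<open>n ^ 21\<close>.\<close>

lemma planar_bound:
  fixes n :: nat
  assumes n: "2 \<le> n"
  shows "((Suc (4 * n\<^sup>2) + 1) ^ 4 + 2) ^ Suc (4 * n\<^sup>2) + 5 \<le> n ^ (110 * n\<^sup>2)"
proof -
  have n2: "4 \<le> n\<^sup>2" using power_mono[OF n, of 2] by simp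
  have n3: "8 \<le> n ^ 3" using power_mono[OF n, of 3] by simp
  have "Suc (4 * n\<^sup>2) + 1 \<le> 8 * n\<^sup>2" using n2 by simp
  also have "\<dots> \<le> n ^ 3 * n\<^sup>2" using n3 by (rule mult_le_mono1)
  finally have "Suc (4 * n\<^sup>2) + 1 \<le> n ^ 5" by (simp add: power_add[symmetric])
  then have "(Suc (4 * n\<^sup>2) + 1) ^ 4 \<le> (n ^ 5) ^ 4" by (rule power_mono) simp
  then have "(Suc (4 * n\<^sup>2) + 1) ^ 4 + 2 \<le> n ^ 20 + 2" by (simp only: power_mult[symmetric]) simp
  also have "\<dots> \<le> 2 * n ^ 20" using power_mono[OF n, of 20] by simp
  also have "\<dots> \<le> n * n ^ 20" using n by (intro mult_right_mono) auto
  finally have "(Suc (4 * n\<^sup>2) + 1) ^ 4 + 2 \<le> n ^ 21" by (simp only: power_Suc[symmetric]) simp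
  then have "((Suc (4 * n\<^sup>2) + 1) ^ 4 + 2) ^ Suc (4 * n\<^sup>2) \<le> (n ^ 21) ^ Suc (4 * n\<^sup>2)"
    by (rule power_mono) simp
  also have "\<dots> = n ^ (21 * Suc (4 * n\<^sup>2))" by (simp only: power_mult)
  finally have a: "((Suc (4 * n\<^sup>2) + 1) ^ 4 + 2) ^ Suc (4 * n\<^sup>2) \<le> n ^ (21 * Suc (4 * n\<^sup>2))" .
  let ?e = "21 * Suc (4 * n\<^sup>2)"
  have "5 \<le> n ^ 3" using n3 by simp
  also have "\<dots> \<le> n ^ ?e" using n by (intro power_increasing) auto
  finally have "n ^ ?e + 5 \<le> 2 * n ^ ?e" by simp
  also have "\<dots> \<le> n ^ Suc ?e" unfolding power_Suc using n by (rule mult_le_mono1)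
  \<comment> \<open>The exponent is \<open>84 * n^2 + 22\<close>, and
    \<open>22 \<le> 26 * n^2\<close>.\<close>
  also have "\<dots> \<le> n ^ (110 * n\<^sup>2)" using n n2 by (intro power_increasing) auto
  finally show ?thesis using a by linarith
qed

text \<open>The power is at most \<open>4 ^ (K ^ Suc d)\<close>, that is, 2 to the power
  \<open>2 * K ^ Suc d\<close>. As \<open>L = K + d\<close> is at least 3, one more factor
  \<open>L\<close> in the exponent absorbs the 2 and the summand \<open>d + 2\<close>.\<close>

lemma step_bound:
  fixes K d :: nat
  assumes "2 \<le> d" "1 \<le> K"
  shows "(3 ^ (K ^ d) + 1) ^ K + d + 2 \<le> 2 ^ ((K + d) ^ (d + 2))"
proof -
  define L where "L = K + d"
  have L: "3 \<le> L" "K \<le> L" "d + 2 \<le> Suc L" using assms by (auto simp: L_def)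
  have "3 ^ m + 1 \<le> (4::nat) ^ m" if "1 \<le> m" for m
    using that by (induction m rule: nat_induct_at_least) auto
  then have "(3 ^ (K ^ d) + 1) ^ K \<le> ((4::nat) ^ (K ^ d)) ^ K"
    using assms by (intro power_mono) auto
  also have "\<dots> = (2 ^ 2) ^ (K ^ d * K)" by (simp add: power_mult)
  also have "\<dots> = 2 ^ (2 * K ^ Suc d)" by (simp only: power_mult[symmetric] power_Suc mult.commute)
  also have "\<dots> \<le> 2 ^ (2 * L ^ Suc d)"
    using L by (intro power_increasing mult_left_mono power_mono) auto
  finally have a: "(3 ^ (K ^ d) + 1) ^ K \<le> (2::nat) ^ (2 * L ^ Suc d)" .
  have L1: "L \<le> L ^ Suc d" using L by simp
  have "d + 2 \<le> 2 ^ L" using L less_exp[of L] by linarith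
  also have "\<dots> \<le> 2 ^ (2 * L ^ Suc d)" using L1 by (intro power_increasing) auto
  finally have "(3 ^ (K ^ d) + 1) ^ K + d + 2 \<le> (2::nat) ^ Suc (2 * L ^ Suc d)" using a by simp
  also have "\<dots> \<le> 2 ^ (L ^ (d + 2))"
  proof (intro power_increasing)
    have "Suc (2 * L ^ Suc d) \<le> 3 * L ^ Suc d" using L L1 by linarith
    also have "\<dots> \<le> L * L ^ Suc d" using L(1) by (rule mult_le_mono1)
    finally show "Suc (2 * L ^ Suc d) \<le> L ^ (d + 2)" by simp
  qed simp
  finally show ?thesis by (simp add: L_def)
qed

text \<open>For \<open>M\<close> up to \<open>2 powr y\<close>, \<open>Suc M + d\<close> is at most
  \<open>2 powr ((d + 3) * y)\<close>, and raising it to the power \<open>d + 2\<close> multiplies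
  this exponent by \<open>d + 2\<close>. The whole loss is a constant factor on
  \<open>y\<close>.\<close>

lemma step_bound_powr:
  fixes M d :: nat and y :: real
  assumes d: "2 \<le> d" and M: "real M \<le> 2 powr y" and y: "1 \<le> y"
  shows "real ((3 ^ (Suc M ^ d) + 1) ^ Suc M + d + 2) \<le> 2 powr (2 powr (real ((d + 3) * (d + 2)) * y))"
proof -
  have "1 \<le> 2 powr y" using y by (simp add: ge_one_powr_ge_zero)
  then have "real (d + 1) \<le> real (d + 1) * 2 powr y" by simp
  then have "real (Suc M + d) \<le> real (d + 2) * 2 powr y"
    using M by (simp add: algebra_simps)
  also have "real (d + 2) \<le> real (2 ^ (d + 2))"
    using less_exp[of "d + 2"] by (metis less_imp_le of_nat_mono)
  also have "real (2 ^ (d + 2)) = 2 powr real (d + 2)" by (subst powr_realpow) simp_all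
  also have "\<dots> \<le> 2 powr (real (d + 2) * y)"
    using mult_left_mono[OF y, of "real (d + 2)"] by (intro powr_mono) auto
  also have "2 powr (real (d + 2) * y) * 2 powr y = 2 powr (real (d + 3) * y)"
    by (simp add: powr_add[symmetric] algebra_simps)
  finally have "real (Suc M + d) \<le> 2 powr (real (d + 3) * y)" by simp
  then have "real (Suc M + d) ^ (d + 2) \<le> (2 powr (real (d + 3) * y)) ^ (d + 2)"
    by (rule power_mono) simp
  also have "\<dots> = 2 powr (real (d + 2) * (real (d + 3) * y))"
    by (rule powr_power) auto
  also have "real (d + 2) * (real (d + 3) * y) = real ((d + 3) * (d + 2)) * y"
    by (simp add: algebra_simps)
  finally have e: "real ((Suc M + d) ^ (d + 2)) \<le> 2 powr (real ((d + 3) * (d + 2)) * y)"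
    by (simp only: of_nat_power)
  have "real ((3 ^ (Suc M ^ d) + 1) ^ Suc M + d + 2) \<le> real (2 ^ ((Suc M + d) ^ (d + 2)))"
    using step_bound[OF d, of "Suc M"] by (intro of_nat_mono) simp
  also have "\<dots> = 2 powr real ((Suc M + d) ^ (d + 2))"
    by (simp only: of_nat_power of_nat_numeral powr_realpow[OF zero_less_numeral, symmetric])
  also have "\<dots> \<le> 2 powr (2 powr (real ((d + 3) * (d + 2)) * y))"
    using e by (intro powr_mono) auto
  finally show ?thesis .
qed

lemma forces_homogeneous_tower:
  assumes "3 \<le> d"
  shows "\<exists>c::nat. 1 \<le> c \<and> (\<forall>n\<ge>2. \<exists>N. forces_homogeneous TYPE('i) d n N \<and>
    real N \<le> twr (d - 1) (real c * ((real n)\<^sup>2 * log 2 (real n))))"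
  using assms
proof (induction d rule: nat_induct_at_least)
  case base
  have "\<exists>N. forces_homogeneous TYPE('i) 3 n N \<and>
    real N \<le> twr (3 - 1) (real 110 * ((real n)\<^sup>2 * log 2 (real n)))" if n: "2 \<le> n" for n
  proof (intro exI conjI)
    let ?N = "((Suc (4 * n\<^sup>2) + 1) ^ 4 + 2) ^ Suc (4 * n\<^sup>2) + 5"
    show "forces_homogeneous TYPE('i) 3 n ?N"
      by (rule forces_homogeneous_3[OF forces_homogeneous_2[OF n]])
    have "real ?N \<le> real (n ^ (110 * n\<^sup>2))"
      using planar_bound[OF n] by (rule of_nat_mono)
    also have "\<dots> = (2 powr log 2 (real n)) ^ (110 * n\<^sup>2)"
      using n by simp
    also have "\<dots> = 2 powr (real (110 * n\<^sup>2) * log 2 (real n))"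
      by (rule powr_power) auto
    also have "\<dots> = twr (3 - 1) (real 110 * ((real n)\<^sup>2 * log 2 (real n)))"
      by (simp add: numeral_2_eq_2 mult.assoc)
    finally show "real ?N \<le> twr (3 - 1) (real 110 * ((real n)\<^sup>2 * log 2 (real n)))" .
  qed
  then show ?case by (intro exI[of _ 110]) auto
next
  case (Suc d)
  then obtain c :: nat where c: "1 \<le> c" and
    IH: "\<And>n. 2 \<le> n \<Longrightarrow> \<exists>N. forces_homogeneous TYPE('i) d n N \<and>
      real N \<le> twr (d - 1) (real c * ((real n)\<^sup>2 * log 2 (real n)))"
    by blast
  \<comment> \<open>As \<open>3 \<le> d\<close>, \<open>twr (d - 1)\<close> has an outermost
    exponential, so \<open>step_bound_powr\<close> applies with \<open>y = twr (Suc e) ?x\<close>;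
    \<open>mult_twr_le\<close> then moves the factor \<open>?k\<close> down to the argument.\<close>
  obtain e where e: "d = Suc (Suc (Suc e))"
    using Suc.hyps by (metis Suc_le_D numeral_3_eq_3 Suc_le_mono)
  let ?k = "(d + 3) * (d + 2)"
  have "\<exists>N. forces_homogeneous TYPE('i) (Suc d) n N \<and>
    real N \<le> twr (Suc d - 1) (real (?k * c) * ((real n)\<^sup>2 * log 2 (real n)))" if n: "2 \<le> n" for n
  proof -
    let ?x = "real c * ((real n)\<^sup>2 * log 2 (real n))"
    have "1 \<le> log 2 (real n)" using n by simp
    moreover have "1 \<le> (real n)\<^sup>2" using n by simp
    ultimately have "1 \<le> (real n)\<^sup>2 * log 2 (real n)"
      using mult_mono[of 1 "(real n)\<^sup>2" 1 "log 2 (real n)"] by simp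
    then have x: "1 \<le> ?x"
      using c mult_mono[of 1 "real c" 1 "(real n)\<^sup>2 * log 2 (real n)"] by simp
    obtain M where M: "forces_homogeneous TYPE('i) d n M" "real M \<le> twr (d - 1) ?x"
      using IH[OF n] by blast
    let ?N = "(3 ^ (Suc M ^ d) + 1) ^ Suc M + d + 2"
    have "forces_homogeneous TYPE('i) (Suc d) n ?N"
      using Suc.hyps by (intro forces_homogeneous_Suc M(1)) simp
    moreover have "real ?N \<le> twr (Suc d - 1) (real (?k * c) * ((real n)\<^sup>2 * log 2 (real n)))"
    proof -
      have "real M \<le> 2 powr twr (Suc e) ?x" using M(2) e by simp
      then have "real ?N \<le> 2 powr (2 powr (real ?k * twr (Suc e) ?x))"
        using Suc.hyps by (intro step_bound_powr twr_ge_1 x) auto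
      also have "\<dots> \<le> 2 powr (2 powr twr (Suc e) (real ?k * ?x))"
        using mult_twr_le[of ?k ?x e] x by (intro powr_mono) auto
      also have "\<dots> = twr (Suc d - 1) (real (?k * c) * ((real n)\<^sup>2 * log 2 (real n)))"
        unfolding e by (simp add: mult.assoc)
      finally show ?thesis .
    qed
    ultimately show ?thesis by blast
  qed
  moreover have "1 \<le> ?k * c" using c by simp
  ultimately show ?case by blast
qed

section \<open>Hyperplanes as equations\<close>

text \<open>Each hyperplane serves as the index of an equation chosen for it, and points of the
  space correspond to functions on \<open>{..<d}\<close>.\<close>

lemma forces_one_sided_of_homogeneous:
  assumes forces: "forces_homogeneous TYPE(real vec set) d n N" and d: "0 < d"
  shows "forces_one_sided d n N"
  unfolding forces_one_sided_def
proof (intro allI impI; elim conjE)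
  fix H assume fH: "finite H" and cH: "card H = N" and hyp: "\<forall>h\<in>H. is_hyperplane d h"
    and pos: "general_position d H"
  have "\<forall>h\<in>H. \<exists>p. fst p \<in> carrier_vec d \<and> h = {x \<in> carrier_vec d. fst p \<bullet> x = snd p}"
    using hyp unfolding is_hyperplane_def by (metis fst_conv snd_conv)
  then obtain p :: "real vec set \<Rightarrow> real vec \<times> real" where
    p: "\<And>h. h \<in> H \<Longrightarrow> fst (p h) \<in> carrier_vec d \<and> h = {x \<in> carrier_vec d. fst (p h) \<bullet> x = snd (p h)}"
    by metis
  define a b where "a = (\<lambda>h k. fst (p h) $ k)" and "b = (\<lambda>h. snd (p h))"
  have dot: "fst (p h) \<bullet> v = (\<Sum>k\<in>{..<d}. a h k * v $ k)" if "v \<in> carrier_vec d" for h v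
    using that by (simp add: scalar_prod_def a_def lessThan_atLeast0)
  have mem: "v \<in> h \<longleftrightarrow> v \<in> carrier_vec d \<and> (\<Sum>k\<in>{..<d}. a h k * v $ k) = b h" if "h \<in> H" for h v
  proof -
    have "v \<in> h \<longleftrightarrow> v \<in> {x \<in> carrier_vec d. fst (p h) \<bullet> x = snd (p h)}"
      using p[OF that] by blast
    then show ?thesis using dot[of v h] unfolding b_def mem_Collect_eq by metis
  qed
  have sols_iff: "sols a b {..<d} T (\<lambda>k. v $ k) \<longleftrightarrow> v \<in> \<Inter>T"
    if "T \<subseteq> H" "v \<in> carrier_vec d" for T v
    using mem that by (auto simp: sols_def)
  have sols_vec: "sols a b {..<d} T x \<longleftrightarrow> vec d x \<in> \<Inter>T" if "T \<subseteq> H" for T x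
  proof -
    have "sols a b {..<d} T x \<longleftrightarrow> sols a b {..<d} T (\<lambda>k. vec d x $ k)"
      by (rule sols_cong) simp
    then show ?thesis using sols_iff[OF that, of "vec d x"] by simp
  qed
  have vertex: "\<exists>v. \<Inter>T = {v}" if "T \<subseteq> H" "card T = d" for T
    using pos that by (simp add: general_position_def)
  have carr: "v \<in> carrier_vec d" if T: "T \<subseteq> H" "card T = d" "v \<in> \<Inter>T" for T v
  proof -
    have "T \<noteq> {}" using T(2) d by auto
    then show ?thesis using T mem by blast
  qed
  have gp: "gen_pos a b {..<d} H"
    unfolding gen_pos_def card_lessThan
  proof (intro conjI allI impI; elim conjE)
    {
      fix T assume T: "T \<subseteq> H" "card T = d"
      then obtain v where v: "\<Inter>T = {v}" using vertex by blast
      then show "\<exists>x. sols a b {..<d} T x" using sols_iff[OF T(1) carr[OF T]] by blast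
      fix x y assume "sols a b {..<d} T x" "sols a b {..<d} T y"
      then have "vec d x = vec d y" using sols_vec[OF T(1)] v by auto
      then show "\<forall>k\<in>{..<d}. x k = y k" by (metis index_vec lessThan_iff)
    }
    fix T x assume T: "T \<subseteq> H" "card T = Suc d"
    show "\<not> sols a b {..<d} T x"
    proof
      assume s: "sols a b {..<d} T x"
      \<comment> \<open>A solution of \<open>d + 1\<close> equations would be the vertex of each
        \<open>d\<close>-subset \<open>T - {f}\<close>; two different choices of \<open>f\<close>
        contradict the distinctness of vertices.\<close>
      have "2 \<le> card T" using T(2) d by simp
      then obtain S where "S \<subseteq> T" "card S = 2" by (meson obtain_subset_with_card_n)
      then obtain g h where gh: "g \<in> T" "h \<in> T" "g \<noteq> h" by (auto simp: card_2_iff)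
      have *: "\<Inter>(T - {f}) = {vec d x}" "card (T - {f}) = d" "T - {f} \<subseteq> H" if "f \<in> T" for f
      proof -
        show c: "card (T - {f}) = d" "T - {f} \<subseteq> H" using T that by auto
        then obtain v where "\<Inter>(T - {f}) = {v}" using vertex by blast
        moreover have "vec d x \<in> \<Inter>(T - {f})" using s sols_vec[OF T(1)] by auto
        ultimately show "\<Inter>(T - {f}) = {vec d x}" by auto
      qed
      have "T - {g} \<noteq> T - {h}" using gh by blast
      then have "\<Inter>(T - {g}) \<noteq> \<Inter>(T - {h})"
        using pos *(2,3)[OF gh(1)] *(2,3)[OF gh(2)] unfolding general_position_def by blast
      then show False using *(1)[OF gh(1)] *(1)[OF gh(2)] by simp
    qed
  qed
  have z: "d - 1 \<in> {..<d}" using d by simp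
  have "\<exists>K. K \<subseteq> H \<and> card K = n \<and> homogeneous a b {..<d} (d - 1) K"
    using forces[unfolded forces_homogeneous_def, rule_format, of "{..<d}" "d - 1" H a b] z fH cH gp by simp
  then obtain K s where K: "K \<subseteq> H" "card K = n" and s: "s \<in> {1, -1}"
    "\<forall>T. T \<subseteq> K \<and> card T = d \<longrightarrow> side a b {..<d} (d - 1) T = s"
    unfolding homogeneous_def card_lessThan by blast
  have sg: "sgn (v $ (d - 1)) = s" if v: "v \<in> arrangement_vertices d K" for v
  proof -
    obtain T where T: "T \<subseteq> K" "card T = d" "\<Inter>T = {v}"
      using v by (auto simp: arrangement_vertices_def)
    have TH: "T \<subseteq> H" using T K by auto
    have "v \<in> carrier_vec d" using carr[OF TH T(2)] T(3) by auto
    then have sol: "sols a b {..<d} T (\<lambda>k. v $ k)" using sols_iff[OF TH] T(3) by auto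
    have "side a b {..<d} (d - 1) T = sgn (v $ (d - 1))"
      using side_eq[OF gp TH _ sol z] T(2) by simp
    then show ?thesis using s(2) T by simp
  qed
  have "one_sided d K"
  proof (cases "s = 1")
    case True
    then show ?thesis using sg by (auto simp: one_sided_def sgn_1_pos)
  next
    case False
    then have "s = -1" using s(1) by simp
    then show ?thesis using sg by (auto simp: one_sided_def sgn_1_neg)
  qed
  then show "\<exists>K\<subseteq>H. card K = n \<and> one_sided d K" using K by blast
qed

theorem theorem4:
  fixes d :: nat
  assumes "d \<ge> 3"
  shows "\<exists>c::real. \<forall>n::nat. n \<ge> 2 \<longrightarrow>
           (\<exists>N. forces_one_sided d n N) \<and>
           real (OSH d n) \<le> twr (d - 1) (c * (real n)\<^sup>2 * log 2 (real n))"
proof -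
  obtain c :: nat where c: "\<And>n. 2 \<le> n \<Longrightarrow> \<exists>N. forces_homogeneous TYPE(real vec set) d n N \<and>
      real N \<le> twr (d - 1) (real c * ((real n)\<^sup>2 * log 2 (real n)))"
    using forces_homogeneous_tower[OF assms] by blast
  show ?thesis
  proof (intro exI[of _ "real c"] allI impI)
    fix n :: nat assume "n \<ge> 2"
    from c[OF this] obtain N where N: "forces_homogeneous TYPE(real vec set) d n N"
      "real N \<le> twr (d - 1) (real c * ((real n)\<^sup>2 * log 2 (real n)))" by blast
    \<comment> \<open>\<open>N\<close> serves twice: it shows that the minimum in \<open>OSH\<close>
      exists, and it bounds that minimum.\<close>
    have f: "forces_one_sided d n N"
      using forces_one_sided_of_homogeneous[OF N(1)] assms by simp
    then have "OSH d n \<le> N" unfolding OSH_def by (rule Least_le)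
    then have "real (OSH d n) \<le> twr (d - 1) (real c * ((real n)\<^sup>2 * log 2 (real n)))"
      using N(2) by linarith
    then show "(\<exists>N. forces_one_sided d n N) \<and>
        real (OSH d n) \<le> twr (d - 1) (real c * (real n)\<^sup>2 * log 2 (real n))"
      using f by (auto simp: mult.assoc)
  qed
qed

end
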